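(* Let $A$ be a derived $p$-complete $\delta$-Cartier ring if $p>2$ (resp. a derived $2$-complete $\delta$-$\widetilde{\mathrm C}$artier ring if $p=2$). Put $$I=\bigcap_{i\ge0}\tilde V^i(A).$$ Then $I^2=0$, and $\delta$ restricts to an isomorphism $\delta:I\xrightarrow{\sim}I$. On $I$, $\delta$ and $\tilde V$ are inverse to each other.
   Context: All rings are commutative with unit; $p$ is a prime. A $\delta$-ring is a ring $A$ with a map $\delta:A\to A$ such that $\delta(0)=\delta(1)=0$, $\delta(x+y)=\delta(x)+\delta(y)-\sum_{i=1}^{p-1}\frac1p\binom pi x^iy^{p-i}$ and $\delta(xy)=x^p\delta(y)+y^p\delta(x)+p\delta(x)\delta(y)$; its Frobenius is $F(a)=a^p+p\delta(a)$. Convention: if $p>2$ one considers $\delta$-Cartier rings, i.e. $\delta$-rings $A$ with an additive map $V:A\to A$ such that $F(V(a))=pa$, $aV(b)=V(F(a)b)$, $\delta(V(a))=a-p^{p-2}V(a^p)$ for all $a,b$, and writes $\tilde V=V$. If $p=2$ one considers $\delta$-$\widetilde{\mathrm C}$artier rings, i.e. $\delta$-rings $A$ with an additive map $\tilde V:A\to A$ such that, with $\tilde 2:=F(\tilde V(1))$, one has $\tilde 2^2=4$, $\delta(\tilde 2)=-1$, $F(\tilde V(a))=\tilde 2a$, $a\tilde V(b)=\tilde V(F(a)b)$, $\delta(\tilde V(a))=-a+\tilde V(\tilde 2\delta(a))$ for all $a,b$. *)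

theory Defs
  imports "HOL-Algebra.Ideal_Product" "HOL-Computational_Algebra.Primes"
begin

(* Clashes with the multiple [n] \<cdot> a: otherwise \<open>[n]\<close> also parses as a list. *)
no_notation ideal_prod (infixl \<open>\<cdot>\<index>\<close> 80)

text \<open>
  Rings are handled with the carrier-based locale \<^locale>\<open>cring\<close>, which (unlike the type class of
  commutative rings with unit) admits the zero ring. For a natural number \<open>n\<close>, \<open>[n] \<cdot> a\<close> is the
  \<open>n\<close>-fold sum of \<open>a\<close>.

  In the additivity axiom, the coefficient \<open>(p choose i) div p\<close> is an exact quotient, since
  \<open>p\<close> is prime and \<open>0 < i < p\<close>.
\<close>

locale delta_ring = cring A for A (structure) +
  fixes p :: nat and \<delta> :: "'a \<Rightarrow> 'a"
  assumes prime_p: "prime p"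
    and delta_closed: "\<delta> \<in> carrier A \<rightarrow> carrier A"
    and delta_zero: "\<delta> \<zero> = \<zero>"
    and delta_one: "\<delta> \<one> = \<zero>"
    and delta_add: "\<lbrakk>x \<in> carrier A; y \<in> carrier A\<rbrakk> \<Longrightarrow>
      \<delta> (x \<oplus> y) = \<delta> x \<oplus> \<delta> y \<ominus>
        (\<Oplus>i\<in>{1..p - 1}. [((p choose i) div p)] \<cdot> (x [^] i \<otimes> y [^] (p - i)))"
    and delta_mult: "\<lbrakk>x \<in> carrier A; y \<in> carrier A\<rbrakk> \<Longrightarrow>
      \<delta> (x \<otimes> y) = x [^] p \<otimes> \<delta> y \<oplus> y [^] p \<otimes> \<delta> x \<oplus> [p] \<cdot> (\<delta> x \<otimes> \<delta> y)"
begin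

definition frob :: "'a \<Rightarrow> 'a" where
  "frob a = a [^] p \<oplus> [p] \<cdot> \<delta> a"

end

locale delta_Cartier_ring = delta_ring +
  fixes V :: "'a \<Rightarrow> 'a"
  assumes p_gt_2: "p > 2"
    and V_additive: "V \<in> hom (add_monoid A) (add_monoid A)"
    and frob_V: "a \<in> carrier A \<Longrightarrow> frob (V a) = [p] \<cdot> a"
    and mult_V: "\<lbrakk>a \<in> carrier A; b \<in> carrier A\<rbrakk> \<Longrightarrow> a \<otimes> V b = V (frob a \<otimes> b)"
    and delta_V: "a \<in> carrier A \<Longrightarrow> \<delta> (V a) = a \<ominus> [(p ^ (p - 2))] \<cdot> V (a [^] p)"

text \<open>The element $\tilde 2 = F(\tilde V(1))$.\<close>

definition (in delta_ring) two_tilde :: "('a \<Rightarrow> 'a) \<Rightarrow> 'a" where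
  "two_tilde V = frob (V \<one>)"

locale delta_tilde_Cartier_ring = delta_ring A 2 \<delta> for A (structure) and \<delta> :: "'a \<Rightarrow> 'a" +
  fixes V :: "'a \<Rightarrow> 'a"
  assumes V_additive: "V \<in> hom (add_monoid A) (add_monoid A)"
    and two_tilde_square: "two_tilde V [^] (2::nat) = [(4::nat)] \<cdot> \<one>"
    and delta_two_tilde: "\<delta> (two_tilde V) = \<ominus> \<one>"
    and frob_V: "a \<in> carrier A \<Longrightarrow> frob (V a) = two_tilde V \<otimes> a"
    and mult_V: "\<lbrakk>a \<in> carrier A; b \<in> carrier A\<rbrakk> \<Longrightarrow> a \<otimes> V b = V (frob a \<otimes> b)"
    and delta_V: "a \<in> carrier A \<Longrightarrow> \<delta> (V a) = \<ominus> a \<oplus> V (two_tilde V \<otimes> \<delta> a)"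

text \<open>
  \<open>A\<close> is derived \<open>p\<close>-complete iff the derived limit of the tower
  $\cdots \to A \to A \to A$ with all transition maps multiplication by \<open>p\<close> is zero. That derived limit
  is the (shifted) cone of the map $(x_n)_n \mapsto (x_n - p x_{n+1})_n$ on the product of countably
  many copies of \<open>A\<close>: the kernel is $\lim = \mathrm{Hom}(\mathbf Z[1/p], A)$, and the cokernel is
  $\lim^1 = \mathrm{Ext}^1(\mathbf Z[1/p], A)$. So it vanishes iff this map is bijective.
\<close>

definition derived_complete :: "('a, 'b) ring_scheme \<Rightarrow> nat \<Rightarrow> bool" where
  "derived_complete A p \<longleftrightarrow>
    bij_betw (\<lambda>x n. x n \<ominus>\<^bsub>A\<^esub> [p] \<cdot>\<^bsub>A\<^esub> x (Suc n))
      ((UNIV :: nat set) \<rightarrow> carrier A) ((UNIV :: nat set) \<rightarrow> carrier A)"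

end

theory Submission
  imports Defs "HOL-Algebra.Multiplicative_Group"
begin

text \<open>
  Let \<open>I\<close> be the intersection of the images of the iterates of \<open>V\<close>. The projection formula makes
  every image an ideal, so \<open>I\<close> is an ideal. If \<open>V\<close> is injective, then it maps \<open>I\<close> bijectively onto
  itself, so elements \<open>x\<close>, \<open>y\<close> of \<open>I\<close> have unique \<open>V\<close>-divided sequences
  \<open>x = V\<^sup>n x\<^sub>n\<close>, \<open>y = V\<^sup>n y\<^sub>n\<close> inside \<open>I\<close>. Suppose moreover that
  \<open>V a \<cdot> V b = p V (a b)\<close> for \<open>a\<close> in the image of \<open>V\<close>. Then \<open>z\<^sub>n = V\<^sup>n (x\<^sub>n y\<^sub>n)\<close> satisfies
  \<open>z\<^sub>n = p z\<^sub>n\<^sub>+\<^sub>1\<close>, so \<open>(z\<^sub>n)\<close> is an element of \<open>lim (\<dots> \<rightarrow> A \<rightarrow> A)\<close> along multiplication by \<open>p\<close>. This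
  limit vanishes by derived completeness, hence \<open>x y = z\<^sub>0 = 0\<close> (lemma \<open>core_square_zero\<close>). Note that
  \<open>x y \<in> p\<^sup>n A\<close> for all \<open>n\<close> would not be enough, since a derived complete ring need not be
  \<open>p\<close>-adically separated.

  Once products in \<open>I\<close> vanish, so do the mixed terms in the formula for \<open>\<delta> (x + y)\<close>, and
  \<open>\<delta>\<close> is additive on \<open>I\<close>. The vanishing of \<open>x\<^sup>p\<close> also turns the formula for \<open>\<delta> (V x)\<close> into
  \<open>\<delta> (V x) = x\<close> (immediately for odd \<open>p\<close>, after a computation with \<open>F x = 2 \<delta> x\<close> for \<open>p = 2\<close>),
  so \<open>\<delta>\<close> is the inverse of the bijection \<open>V\<close> of \<open>I\<close>.

  It remains to verify, for each type of Cartier ring, that \<open>V\<close> is injective and satisfies the product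
  formula. For odd \<open>p\<close> this is a short computation. For \<open>p = 2\<close> the decisive point is that
  \<open>t = F (V 1)\<close> acts as \<open>2\<close> on the image of \<open>V\<close>: the projection formula reads
  \<open>t \<cdot> V a = V (F t \<cdot> a)\<close>, and \<open>F t = t\<^sup>2 + 2 \<delta> t = 4 - 2 = 2\<close>.
\<close>

section \<open>Injective Verschiebung operators and their core\<close>

locale additive_endomorphism = cring A for A (structure) +
  fixes V :: "'a \<Rightarrow> 'a"
  assumes hom_V: "V \<in> hom (add_monoid A) (add_monoid A)"
begin

lemma V_closed [simp, intro]: "a \<in> carrier A \<Longrightarrow> V a \<in> carrier A"
  using hom_V by (auto simp: hom_def)

lemma V_add: "\<lbrakk>a \<in> carrier A; b \<in> carrier A\<rbrakk> \<Longrightarrow> V (a \<oplus> b) = V a \<oplus> V b"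
  using hom_V by (auto simp: hom_def)

lemma V_zero [simp]: "V \<zero> = \<zero>"
  using hom_V abelian_group.a_group[OF is_abelian_group]
  by (metis (no_types, lifting) hom_one monoid.simps(2))

lemma V_minus:
  assumes "a \<in> carrier A" "b \<in> carrier A"
  shows "V (a \<ominus> b) = V a \<ominus> V b"
proof -
  have "V a = V (a \<ominus> b) \<oplus> V b"
    using assms V_add[of "a \<ominus> b" b] by (simp add: minus_eq a_assoc l_neg)
  then show ?thesis
    using assms by (simp add: minus_eq a_assoc r_neg)
qed

lemma V_add_pow: "a \<in> carrier A \<Longrightarrow> V ([(n::nat)] \<cdot> a) = [n] \<cdot> V a"
  by (induction n) (simp_all add: V_add)

lemma V_pow_closed: "a \<in> carrier A \<Longrightarrow> (V ^^ n) a \<in> carrier A"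
  by (induction n) auto

lemma V_pow_additive: "additive_endomorphism A (V ^^ n)"
proof
  show "V ^^ n \<in> hom (add_monoid A) (add_monoid A)"
  proof (induction n)
    case (Suc n)
    then show ?case
      by (auto simp: hom_def V_add Pi_iff)
  qed (auto simp: hom_def)
qed

definition core :: "'a set" where
  "core = (\<Inter>i. (V ^^ i) ` carrier A)"

lemma core_closed: "x \<in> core \<Longrightarrow> x \<in> carrier A"
  by (auto simp: core_def dest: spec[of _ 0])

lemma V_core: "x \<in> core \<Longrightarrow> V x \<in> core"
proof -
  assume x: "x \<in> core"
  have "V x \<in> (V ^^ i) ` carrier A" for i
  proof -
    obtain a where "a \<in> carrier A" "x = (V ^^ i) a"
      using x by (auto simp: core_def)
    then show ?thesis
      by (auto simp: funpow_swap1)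
  qed
  then show ?thesis
    by (simp add: core_def)
qed

end

text \<open>
  The product formula \<open>V_mult_V\<close> asks that \<open>a\<close> lie in the image of \<open>V\<close> so that the prime \<open>2\<close> is
  covered: there \<open>V a \<cdot> V b = V (t a b)\<close>, and \<open>t a = 2 a\<close> is known for \<open>a\<close> in that image only.
  In the core this costs nothing, since each of its elements lies in the image.
\<close>

locale verschiebung = additive_endomorphism A V for A (structure) and V +
  fixes p :: nat and \<phi> :: "'a \<Rightarrow> 'a"
  assumes phi_closed: "a \<in> carrier A \<Longrightarrow> \<phi> a \<in> carrier A"
    and projection_formula: "\<lbrakk>a \<in> carrier A; b \<in> carrier A\<rbrakk> \<Longrightarrow> a \<otimes> V b = V (\<phi> a \<otimes> b)"
    and V_eq_zeroD: "\<lbrakk>a \<in> carrier A; V a = \<zero>\<rbrakk> \<Longrightarrow> a = \<zero>"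
    and V_mult_V: "\<lbrakk>a \<in> V ` carrier A; b \<in> carrier A\<rbrakk> \<Longrightarrow> V a \<otimes> V b = [p] \<cdot> V (a \<otimes> b)"
begin

lemma V_cancel:
  assumes "a \<in> carrier A" "b \<in> carrier A" "V a = V b"
  shows "a = b"
proof -
  have "V (a \<ominus> b) = \<zero>"
    using assms V_minus[of a b] by simp
  then have "a \<ominus> b = \<zero>"
    using assms V_eq_zeroD by simp
  then show ?thesis
    using assms by simp
qed

lemma image_V_pow_absorbs:
  assumes "r \<in> carrier A" "a \<in> carrier A"
  shows "r \<otimes> (V ^^ n) a \<in> (V ^^ n) ` carrier A"
  using assms(1)
proof (induction n arbitrary: r)
  case 0
  then show ?case using assms by simp
next
  case (Suc n)
  have "r \<otimes> (V ^^ Suc n) a = V (\<phi> r \<otimes> (V ^^ n) a)"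
    using Suc.prems assms by (simp add: projection_formula V_pow_closed)
  then show ?case
    using Suc.IH[of "\<phi> r"] Suc.prems phi_closed by auto
qed

lemma ideal_core: "ideal core A"
proof (rule idealI)
  show "ring A" by (rule ring_axioms)
  have sub: "subgroup ((V ^^ i) ` carrier A) (add_monoid A)" for i
  proof -
    interpret group_hom "add_monoid A" "add_monoid A" "V ^^ i"
      using additive_endomorphism.hom_V[OF V_pow_additive[of i]] a_group
      by (simp add: group_hom_def group_hom_axioms_def)
    show ?thesis
      using img_is_subgroup by simp
  qed
  show "subgroup core (add_monoid A)"
    unfolding core_def using add.subgroups_Inter[of "range (\<lambda>i. (V ^^ i) ` carrier A)"] sub
    by blast
next
  fix a x assume a: "a \<in> core" and x: "x \<in> carrier A"
  have "x \<otimes> a \<in> (V ^^ i) ` carrier A" for i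
    using a x image_V_pow_absorbs[of x _ i] unfolding core_def by blast
  then show "x \<otimes> a \<in> core"
    by (simp add: core_def)
  then show "a \<otimes> x \<in> core"
    using a x by (simp add: m_comm core_closed)
qed

text \<open>
  Injectivity makes the preimage \<open>y\<close> of \<open>x\<close> independent of the depth \<open>i\<close> of the representation
  \<open>x = V\<^sup>i\<^sup>+\<^sup>1 a\<close>, so that \<open>y = V\<^sup>i a\<close> for all \<open>i\<close> at once.
\<close>

lemma core_divisible:
  assumes "x \<in> core"
  shows "\<exists>y\<in>core. V y = x"
proof -
  have rep: "\<exists>a\<in>carrier A. x = V ((V ^^ i) a)" for i
    using assms by (fastforce simp: core_def dest: spec[of _ "Suc i"])
  obtain y where y: "y \<in> carrier A" "x = V y"
    using rep[of 0] by auto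
  have "y \<in> (V ^^ i) ` carrier A" for i
    using rep[of i] y V_cancel V_pow_closed by blast
  then show ?thesis
    using y by (auto simp: core_def)
qed

text \<open>
  Derived completeness enters through injectivity of \<open>(x\<^sub>n) \<mapsto> (x\<^sub>n - p x\<^sub>n\<^sub>+\<^sub>1)\<close>: the sequence
  \<open>z\<^sub>n = V\<^sup>n (x\<^sub>n y\<^sub>n)\<close> lies in its kernel and starts with \<open>z\<^sub>0 = x y\<close>.
\<close>

theorem core_square_zero:
  assumes complete: "derived_complete A p" and x: "x \<in> core" and y: "y \<in> core"
  shows "x \<otimes> y = \<zero>"
proof -
  obtain U where U: "\<And>x. x \<in> core \<Longrightarrow> U x \<in> core" "\<And>x. x \<in> core \<Longrightarrow> V (U x) = x"
    using core_divisible by metis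
  have Un: "(U ^^ n) x \<in> core" if "x \<in> core" for n x
    using that by (induction n) (auto intro: U)
  define z where "z n = (V ^^ n) ((U ^^ n) x \<otimes> (U ^^ n) y)" for n
  have z_closed: "z n \<in> carrier A" for n
    using x y Un by (simp add: z_def V_pow_closed core_closed)
  have z_step: "z n = [p] \<cdot> z (Suc n)" for n
  proof -
    let ?a = "(U ^^ Suc n) x" and ?b = "(U ^^ Suc n) y"
    have ab: "?a \<in> core" "?b \<in> core"
      using x y Un by blast+
    have a_image: "?a \<in> V ` carrier A"
      using core_divisible[OF ab(1)] core_closed by (metis image_eqI)
    have "(U ^^ n) x \<otimes> (U ^^ n) y = V ?a \<otimes> V ?b"
      using x y U(2)[OF Un] by simp
    also have "\<dots> = [p] \<cdot> V (?a \<otimes> ?b)"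
      using a_image ab by (intro V_mult_V core_closed)
    finally have "z n = (V ^^ n) ([p] \<cdot> V (?a \<otimes> ?b))"
      by (simp only: z_def)
    also have "\<dots> = [p] \<cdot> (V ^^ n) (V (?a \<otimes> ?b))"
      using ab additive_endomorphism.V_add_pow[OF V_pow_additive] by (simp add: core_closed)
    also have "\<dots> = [p] \<cdot> z (Suc n)"
      by (simp only: z_def funpow_Suc_right o_apply)
    finally show ?thesis .
  qed
  let ?T = "\<lambda>x n. x n \<ominus> [p] \<cdot> x (Suc n)"
  have inj: "inj_on ?T (UNIV \<rightarrow> carrier A)"
    using complete by (simp add: derived_complete_def bij_betw_def)
  have "?T z = ?T (\<lambda>_. \<zero>)"
  proof (rule ext)
    show "?T z n = ?T (\<lambda>_. \<zero>) n" for n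
      using z_closed[of n] z_step[of n] by (simp add: minus_eq r_neg)
  qed
  then have "z = (\<lambda>_. \<zero>)"
    by (rule inj_onD[OF inj]) (use z_closed in auto)
  then have "z 0 = \<zero>" by simp
  then show ?thesis by (simp add: z_def)
qed

end

section \<open>Delta-structures on square-zero ideals\<close>

lemma (in cring) pow_mult_pow_eq_zero:
  assumes "x \<in> carrier R" "y \<in> carrier R" "x \<otimes> y = \<zero>" "0 < i" "0 < (j::nat)"
  shows "x [^] (i::nat) \<otimes> y [^] j = \<zero>"
proof -
  obtain k l where kl: "i = Suc k" "j = Suc l"
    using assms by (metis Suc_pred)
  have "x [^] i \<otimes> y [^] j = (x [^] k \<otimes> y [^] l) \<otimes> (x \<otimes> y)"
    using assms(1,2) by (simp add: kl m_ac)
  then show ?thesis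
    using assms by simp
qed

context delta_ring
begin

lemma delta_in_carrier [simp, intro]: "a \<in> carrier A \<Longrightarrow> \<delta> a \<in> carrier A"
  using delta_closed by auto

lemma frob_closed [simp, intro]: "a \<in> carrier A \<Longrightarrow> frob a \<in> carrier A"
  by (simp add: frob_def)

lemma frob_zero: "frob \<zero> = \<zero>"
  using prime_gt_0_nat[OF prime_p] by (simp add: frob_def delta_zero nat_pow_zero)

lemma delta_add_of_mult_zero:
  assumes "x \<in> carrier A" "y \<in> carrier A" "x \<otimes> y = \<zero>"
  shows "\<delta> (x \<oplus> y) = \<delta> x \<oplus> \<delta> y"
proof -
  have "(\<Oplus>i\<in>{1..p - 1}. [((p choose i) div p)] \<cdot> (x [^] i \<otimes> y [^] (p - i))) = \<zero>"
  proof (rule add.finprod_one_eqI)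
    fix i assume "i \<in> {1..p - 1}"
    then have "0 < i" "0 < p - i" by auto
    then show "[((p choose i) div p)] \<cdot> (x [^] i \<otimes> y [^] (p - i)) = \<zero>"
      using assms by (simp add: pow_mult_pow_eq_zero)
  qed
  then show ?thesis
    using assms by (simp add: delta_add minus_eq)
qed

text \<open>
  The hypothesis \<open>\<delta> (V x) = x\<close> is where the cases \<open>p > 2\<close> and \<open>p = 2\<close> differ. It makes \<open>\<delta>\<close> a left
  inverse of \<open>V\<close> on the core; as \<open>V\<close> maps the core onto itself, \<open>\<delta>\<close> is then a two-sided inverse.
\<close>

lemma core_iso:
  assumes "verschiebung A V p frob" and complete: "derived_complete A p"
    and delta_V_core: "\<And>x. x \<in> additive_endomorphism.core A V \<Longrightarrow> \<delta> (V x) = x"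
  shows "let I = (\<Inter>i::nat. (V ^^ i) ` carrier A);
             I_add = (add_monoid A)\<lparr>carrier := I\<rparr>
         in ideal I A
          \<and> ideal_prod A I I = {\<zero>}
          \<and> \<delta> \<in> iso I_add I_add
          \<and> (\<forall>x\<in>I. V x \<in> I \<and> \<delta> (V x) = x \<and> V (\<delta> x) = x)"
proof -
  interpret verschiebung A V p frob by fact
  interpret core: ideal core A by (rule ideal_core)
  note square_zero = core_square_zero[OF complete]
  have V_delta: "\<delta> x \<in> core \<and> V (\<delta> x) = x" if "x \<in> core" for x
    using core_divisible[OF that] delta_V_core by auto
  have "bij_betw \<delta> core core"
    by (rule bij_betw_byWitness[where f' = V]) (use V_delta delta_V_core V_core in auto)
  moreover have "\<delta> (x \<oplus> y) = \<delta> x \<oplus> \<delta> y" if "x \<in> core" "y \<in> core" for x y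
    using that square_zero by (intro delta_add_of_mult_zero core_closed) auto
  ultimately have iso: "\<delta> \<in> iso ((add_monoid A)\<lparr>carrier := core\<rparr>) ((add_monoid A)\<lparr>carrier := core\<rparr>)"
    using V_delta by (auto simp: iso_def hom_def)
  have "s = \<zero>" if "s \<in> ideal_prod A core core" for s
    using that by (induction rule: ideal_prod.induct) (auto simp: square_zero)
  moreover have "\<zero> \<in> ideal_prod A core core"
    using ideal_prod.prod[of \<zero> core \<zero> core A] core.zero_closed square_zero by auto
  ultimately have "ideal_prod A core core = {\<zero>}" by blast
  then show ?thesis
    unfolding Let_def core_def[symmetric]
    using ideal_core iso V_core delta_V_core V_delta by blast
qed

end

section \<open>Odd primes\<close>

context delta_Cartier_ring
begin

sublocale additive_endomorphism A V
  by unfold_locales (rule V_additive)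

lemma V_mult_V_eq:
  assumes "a \<in> carrier A" "b \<in> carrier A"
  shows "V a \<otimes> V b = [p] \<cdot> V (a \<otimes> b)"
  using assms by (simp add: mult_V frob_V add_pow_ldistr V_add_pow)

text \<open>
  If \<open>V a = 0\<close>, then \<open>p a = F (V a) = 0\<close>, while \<open>\<delta> (V a) = 0\<close> says that \<open>a\<close> is
  \<open>p\<^sup>p\<^sup>-\<^sup>2 V (a\<^sup>p)\<close>. As \<open>p > 2\<close>, the factor \<open>p\<^sup>p\<^sup>-\<^sup>2\<close> contains a \<open>p\<close> that kills \<open>a\<^sup>p\<close>.
\<close>

lemma V_kernel:
  assumes a: "a \<in> carrier A" and "V a = \<zero>"
  shows "a = \<zero>"
proof -
  have pa: "[p] \<cdot> a = \<zero>"
    using assms frob_V[OF a] by (simp add: frob_zero)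
  define q where "q = p - 1"
  have q: "p = Suc q" using p_gt_2 by (simp add: q_def)
  have "[p] \<cdot> (a [^] p) = a [^] q \<otimes> ([p] \<cdot> a)"
    using a add_pow_rdistr[of "a [^] q" a p] by (simp only: q nat_pow_Suc nat_pow_closed)
  then have pap: "[p] \<cdot> (a [^] p) = \<zero>"
    using a pa by simp
  have "p ^ (p - 2) = p * p ^ (p - 3)"
    using p_gt_2 by (metis Suc_diff_Suc numeral_2_eq_2 numeral_3_eq_3 power_Suc)
  then have "[(p ^ (p - 2))] \<cdot> V (a [^] p) = [(p ^ (p - 3))] \<cdot> V ([p] \<cdot> (a [^] p))"
    using a by (simp add: V_add_pow add.nat_pow_pow)
  then have "[(p ^ (p - 2))] \<cdot> V (a [^] p) = \<zero>"
    by (simp add: pap)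
  then show ?thesis
    using assms delta_V[OF a] by (simp add: delta_zero minus_eq)
qed

sublocale verschiebung A V p frob
  by unfold_locales (auto simp: V_mult_V_eq mult_V[symmetric] intro: V_kernel)

lemma delta_V_core:
  assumes "derived_complete A p" "x \<in> core"
  shows "\<delta> (V x) = x"
proof -
  have x: "x \<in> carrier A" using assms by (simp add: core_closed)
  have "x [^] (1::nat) \<otimes> x [^] (p - 1) = \<zero>"
    using x p_gt_2 core_square_zero[OF assms(1,2,2)] by (intro pow_mult_pow_eq_zero) auto
  then have "x [^] p = \<zero>"
    using nat_pow_mult[OF x, of 1 "p - 1"] p_gt_2 by simp
  then show ?thesis
    using x by (simp add: delta_V minus_eq)
qed

end

section \<open>The prime two\<close>

context delta_tilde_Cartier_ring
begin

sublocale additive_endomorphism A V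
  by unfold_locales (rule V_additive)

abbreviation t where "t \<equiv> two_tilde V"

lemma add_pow_two: "a \<in> carrier A \<Longrightarrow> [(2::nat)] \<cdot> a = a \<oplus> a"
  by (simp add: numeral_2_eq_2)

lemma pow_two: "a \<in> carrier A \<Longrightarrow> a [^] (2::nat) = a \<otimes> a"
  by (simp add: numeral_2_eq_2)

lemma frob_eq: "a \<in> carrier A \<Longrightarrow> frob a = a \<otimes> a \<oplus> (\<delta> a \<oplus> \<delta> a)"
  by (simp add: frob_def pow_two add_pow_two)

lemma delta_double:
  assumes "a \<in> carrier A"
  shows "\<delta> (a \<oplus> a) = \<delta> a \<oplus> \<delta> a \<ominus> a \<otimes> a"
proof -
  have "(2 choose 1) div 2 = (1::nat)" by simp
  then show ?thesis
    using delta_add[OF assms assms] assms by simp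
qed

lemma t_closed [simp, intro]: "t \<in> carrier A"
  by (simp add: two_tilde_def)

lemma frob_t: "frob t = \<one> \<oplus> \<one>"
proof -
  have four: "[(4::nat)] \<cdot> \<one> = \<one> \<oplus> \<one> \<oplus> \<one> \<oplus> \<one>"
    by (simp add: numeral_eq_Suc)
  have "frob t = \<one> \<oplus> \<one> \<oplus> \<one> \<oplus> \<one> \<oplus> (\<ominus> \<one> \<oplus> \<ominus> \<one>)"
    using two_tilde_square by (simp add: frob_def add_pow_two delta_two_tilde four)
  also have "\<dots> = \<one> \<oplus> \<one>"
    by algebra
  finally show ?thesis .
qed

lemma t_mult_V: "a \<in> carrier A \<Longrightarrow> t \<otimes> V a = V a \<oplus> V a"
  by (simp add: mult_V frob_t l_distr V_add)

lemma V_t_eq: "t = V t \<ominus> (\<one> \<oplus> \<one>)"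
proof -
  have "V \<one> \<otimes> V \<one> = V t"
    by (simp add: mult_V two_tilde_def)
  moreover have "\<delta> (V \<one>) = \<ominus> \<one>"
    by (simp add: delta_V delta_one)
  ultimately have "t = V t \<oplus> (\<ominus> \<one> \<oplus> \<ominus> \<one>)"
    using frob_eq[of "V \<one>"] by (simp add: two_tilde_def)
  then show ?thesis
    by (simp add: minus_eq minus_add)
qed

text \<open>
  If \<open>V a = 0\<close>, then \<open>\<delta> (V a) = 0\<close> gives \<open>a = V (t \<delta> a)\<close>, so it suffices to kill \<open>t \<delta> a\<close>. Since
  \<open>a\<close> lies in the image of \<open>V\<close>, \<open>2 a = t a = F (V a) = 0\<close>, and applying \<open>\<delta>\<close> yields \<open>2 \<delta> a = a\<^sup>2\<close>.
  Therefore \<open>F a = 2 a\<^sup>2 = 0\<close>, so \<open>a\<^sup>2 = V (F a \<cdot> t \<delta> a) = 0\<close> and \<open>2 \<delta> a = 0\<close>. Applying \<open>\<delta>\<close> once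
  more gives \<open>F (\<delta> a) = 2 (\<delta> a)\<^sup>2 = 0\<close>. Finally \<open>t = V t - 2\<close>, whence
  \<open>t \<delta> a = V (F (\<delta> a) t) - 2 \<delta> a = 0\<close>.
\<close>

lemma V_kernel:
  assumes a [simp]: "a \<in> carrier A" and Va: "V a = \<zero>"
  shows "a = \<zero>"
proof -
  have "\<ominus> a \<oplus> V (t \<otimes> \<delta> a) = \<zero>"
    using delta_V[OF a] by (simp add: Va delta_zero)
  then have a_eq: "a = V (t \<otimes> \<delta> a)"
    by (metis a V_closed add.inv_closed add.inv_equality add.inv_inv delta_in_carrier m_closed
        t_closed a_comm)
  have ta: "t \<otimes> a = \<zero>"
    using frob_V[OF a] by (simp add: Va frob_zero)
  have aa: "a \<oplus> a = \<zero>"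
    using t_mult_V[of "t \<otimes> \<delta> a"] ta by (simp flip: a_eq)
  have two_delta: "\<delta> a \<oplus> \<delta> a = a \<otimes> a"
    using delta_double[OF a, symmetric] by (simp add: aa delta_zero)
  have "frob a = (a \<oplus> a) \<otimes> a"
    by (simp add: frob_eq two_delta l_distr)
  then have Fa: "frob a = \<zero>"
    by (simp add: aa)
  have "a \<otimes> a = V (frob a \<otimes> (t \<otimes> \<delta> a))"
    using mult_V[of a "t \<otimes> \<delta> a"] by (simp flip: a_eq)
  then have two_delta_0: "\<delta> a \<oplus> \<delta> a = \<zero>"
    by (simp add: Fa two_delta)
  have two_delta2: "\<delta> (\<delta> a) \<oplus> \<delta> (\<delta> a) = \<delta> a \<otimes> \<delta> a"
    using delta_double[of "\<delta> a", symmetric] by (simp add: two_delta_0 delta_zero)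
  have "frob (\<delta> a) = (\<delta> a \<oplus> \<delta> a) \<otimes> \<delta> a"
    by (simp add: frob_eq two_delta2 l_distr)
  then have F_delta: "frob (\<delta> a) = \<zero>"
    by (simp add: two_delta_0)
  have "\<delta> a \<otimes> t = \<delta> a \<otimes> (V t \<ominus> (\<one> \<oplus> \<one>))"
    using V_t_eq by simp
  also have "\<dots> = \<delta> a \<otimes> V t \<ominus> (\<delta> a \<oplus> \<delta> a)"
    by (simp add: minus_eq r_distr r_minus minus_add)
  also have "\<dots> = \<zero>"
    by (simp add: mult_V F_delta two_delta_0 minus_eq)
  finally show ?thesis
    using a_eq by (simp add: m_comm)
qed

sublocale verschiebung A V 2 frob
proof unfold_locales
  fix a b assume a: "a \<in> V ` carrier A" and b: "b \<in> carrier A"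
  then obtain c where c: "c \<in> carrier A" "a = V c" by auto
  then have "V a \<otimes> V b = V ((a \<oplus> a) \<otimes> b)"
    using b mult_V[of "V a" b] by (simp add: frob_V t_mult_V)
  then show "V a \<otimes> V b = [(2::nat)] \<cdot> V (a \<otimes> b)"
    using b c by (simp add: l_distr V_add add_pow_two)
qed (auto simp: mult_V intro: V_kernel)

text \<open>
  Write \<open>x = V y\<close> with \<open>y\<close> in the core. As \<open>x\<^sup>2 = 0\<close>, \<open>2 \<delta> x = F x = t y = 2 y\<close>. The same value is
  taken by \<open>t \<delta> x\<close>, because \<open>\<delta> x = - y + V (t \<delta> y)\<close> lies in the image of \<open>V\<close>, on which \<open>t\<close> acts as
  \<open>2\<close>. Hence \<open>\<delta> (V x) = - x + V (t \<delta> x) = - x + 2 V y = x\<close>.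
\<close>

lemma delta_V_core:
  assumes complete: "derived_complete A 2" and x_core: "x \<in> core"
  shows "\<delta> (V x) = x"
proof -
  obtain y where y_core: "y \<in> core" and x: "x = V y"
    using core_divisible[OF x_core] by auto
  obtain w where w [simp]: "w \<in> carrier A" and y: "y = V w"
    using core_divisible[OF y_core] core_closed by auto
  have yc [simp]: "y \<in> carrier A" and xc [simp]: "x \<in> carrier A"
    using y_core x_core core_closed by auto
  have ty: "t \<otimes> y = y \<oplus> y"
    by (simp add: y t_mult_V)
  have "frob x = \<delta> x \<oplus> \<delta> x"
    using core_square_zero[OF complete x_core x_core] by (simp add: frob_eq)
  then have two_delta: "\<delta> x \<oplus> \<delta> x = y \<oplus> y"
    using frob_V[OF yc] ty by (simp flip: x)
  have "\<delta> x = V (t \<otimes> \<delta> y) \<ominus> V w"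
    using delta_V[OF yc] by (simp add: x a_comm minus_eq flip: y)
  also have "\<dots> = V (t \<otimes> \<delta> y \<ominus> w)"
    by (simp add: V_minus)
  finally have "t \<otimes> \<delta> x = y \<oplus> y"
    using two_delta by (simp add: t_mult_V)
  then have "\<delta> (V x) = \<ominus> x \<oplus> (x \<oplus> x)"
    by (simp add: delta_V V_add flip: x)
  also have "\<dots> = x"
    by (simp add: r_neg1)
  finally show ?thesis .
qed

end

section \<open>The core of a derived complete Cartier ring\<close>

theorem proposition5p51:
  fixes A :: "('a, 'b) ring_scheme" and p :: nat and \<delta> V :: "'a \<Rightarrow> 'a"
  assumes "prime p"
    and "p > 2 \<Longrightarrow> delta_Cartier_ring A p \<delta> V"
    and "p = 2 \<Longrightarrow> delta_tilde_Cartier_ring A \<delta> V"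
    and "derived_complete A p"
  shows "let I = (\<Inter>i::nat. (V ^^ i) ` carrier A);
             I_add = (add_monoid A)\<lparr>carrier := I\<rparr>
         in ideal I A
          \<and> ideal_prod A I I = {\<zero>\<^bsub>A\<^esub>}
          \<and> \<delta> \<in> iso I_add I_add
          \<and> (\<forall>x\<in>I. V x \<in> I \<and> \<delta> (V x) = x \<and> V (\<delta> x) = x)"
proof (cases "p = 2")
  case True
  interpret delta_tilde_Cartier_ring A \<delta> V
    using assms(3) True by simp
  show ?thesis
    using core_iso[OF verschiebung_axioms] assms(4) delta_V_core True by simp
next
  case False
  then have "p > 2"
    using prime_ge_2_nat[OF assms(1)] by simp
  then interpret delta_Cartier_ring A p \<delta> V
    by (rule assms(2))
  show ?thesis
    using core_iso[OF verschiebung_axioms] assms(4) delta_V_core by simp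
qed

end
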